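(* For every $i\in\mathbb{Z}_4$, the following relation holds on every nonzero finite-dimensional $\square_q$-module $V$ (i.e. as an equality in $\mathrm{End}(V)$): $$\exp_q(\mathfrak{n}_{i,i+1})\,x_{i+3}\,\exp_q(\mathfrak{n}_{i,i+1})^{-1}=x_{i+1}-\frac{x_{i+3}}{(q-q^{-1})^2}+\frac{q\,x_{i+1}^{-1}x_{i+3}x_{i+1}}{(q-q^{-1})(q^2-q^{-2})}+\frac{q^{-1}x_{i+1}x_{i+3}x_{i+1}^{-1}}{(q-q^{-1})(q^2-q^{-2})}.$$
   Context: Let $\mathbb{F}$ be an algebraically closed field and let $0\ne q\in\mathbb{F}$ be not a root of unity. Algebras are associative with $1$. For $n\in\mathbb{Z}$, $[n]_q=(q^n-q^{-n})/(q-q^{-1})$; for $n\in\mathbb{N}=\{0,1,2,\dots\}$, $[n]_q^!=\prod_{k=1}^n[k]_q$ with $[0]_q^!=1$. Let $\mathbb{Z}_4=\mathbb{Z}/4\mathbb{Z}$; indices are taken in $\mathbb{Z}_4$. $\square_q$ is the $\mathbb{F}$-algebra with generators $\{x_i\}_{i\in\mathbb{Z}_4}$ and relations, for $i\in\mathbb{Z}_4$, $$\frac{qx_ix_{i+1}-q^{-1}x_{i+1}x_i}{q-q^{-1}}=1,\qquad x_i^3x_{i+2}-[3]_qx_i^2x_{i+2}x_i+[3]_qx_ix_{i+2}x_i^2-x_{i+2}x_i^3=0.$$ For $i\in\mathbb{Z}_4$ put $\mathfrak{n}_{i,i+1}=\dfrac{q(1-x_ix_{i+1})}{q-q^{-1}}=\dfrac{q^{-1}(1-x_{i+1}x_i)}{q-q^{-1}}\in\square_q$.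 On every nonzero finite-dimensional $\square_q$-module each $x_i$ acts invertibly, and $x_i^{-1}$ denotes the inverse of that action; each $\mathfrak{n}_{i,i+1}$ acts nilpotently. For a nilpotent $\psi\in\mathrm{End}(V)$, $V$ a nonzero finite-dimensional $\mathbb{F}$-vector space, $\exp_q(\psi)=\sum_{n\in\mathbb{N}}\frac{q^{\binom n2}}{[n]_q^!}\psi^n$, which is invertible. *)

theory Defs
  imports
    "HOL-Algebra.QuotRing"
    "HOL-Algebra.Algebraic_Closure_Type"
    "HOL-Computational_Algebra.Polynomial"
    "HOL-Library.Poly_Mapping"
    "HOL-Library.Numeral_Type"
begin

text \<open>
  Words form a monoid under concatenation, so finitely supported functions on words, with the
  convolution product of \<^theory>\<open>HOL-Library.Poly_Mapping\<close>, are the free associative algebra.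
\<close>

instantiation list :: (type) monoid_add
begin

definition zero_list :: "'a list" where "zero_list = []"

definition plus_list :: "'a list \<Rightarrow> 'a list \<Rightarrow> 'a list" where "plus_list = (@)"

instance by standard (simp_all add: zero_list_def plus_list_def)

end

text \<open>
  The index type \<^typ>\<open>4\<close> of \<^theory>\<open>HOL-Library.Numeral_Type\<close> is the ring of integers modulo 4:
  its arithmetic is modular.
\<close>

type_synonym 'a free_alg = "4 list \<Rightarrow>\<^sub>0 'a"

definition free_const :: "'a::field \<Rightarrow> 'a free_alg" where
  "free_const c = Poly_Mapping.single [] c"

definition free_gen :: "4 \<Rightarrow> 'a::field free_alg" where
  "free_gen i = Poly_Mapping.single [i] 1"

definition q_int :: "'a::field \<Rightarrow> int \<Rightarrow> 'a" where
  "q_int q n = (q powi n - q powi (- n)) / (q - inverse q)"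

definition q_fact :: "'a::field \<Rightarrow> nat \<Rightarrow> 'a" where
  "q_fact q n = (\<Prod>k = 1..n. q_int q (int k))"

definition q_weyl_rel :: "'a::field \<Rightarrow> 4 \<Rightarrow> 'a free_alg" where
  "q_weyl_rel q i =
     free_const (1 / (q - inverse q)) *
       (free_const q * free_gen i * free_gen (i + 1)
        - free_const (inverse q) * free_gen (i + 1) * free_gen i)
     - 1"

definition q_serre_rel :: "'a::field \<Rightarrow> 4 \<Rightarrow> 'a free_alg" where
  "q_serre_rel q i =
     free_gen i ^ 3 * free_gen (i + 2)
     - free_const (q_int q 3) * free_gen i ^ 2 * free_gen (i + 2) * free_gen i
     + free_const (q_int q 3) * free_gen i * free_gen (i + 2) * free_gen i ^ 2
     - free_gen (i + 2) * free_gen i ^ 3"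

text \<open>Ideals of \<^theory>\<open>HOL-Algebra.Ideal\<close> are two-sided.\<close>

definition box_ideal :: "'a::field \<Rightarrow> 'a free_alg set" where
  "box_ideal q = genideal ring_of_type_algebra (range (q_weyl_rel q) \<union> range (q_serre_rel q))"

definition box_alg :: "'a::field \<Rightarrow> 'a free_alg set ring" where
  "box_alg q = ring_of_type_algebra Quot box_ideal q"

definition box_proj :: "'a::field \<Rightarrow> 'a free_alg \<Rightarrow> 'a free_alg set" where
  "box_proj q p = box_ideal q +>\<^bsub>ring_of_type_algebra\<^esub> p"

definition box_scale :: "'a::field \<Rightarrow> 'a \<Rightarrow> 'a free_alg set \<Rightarrow> 'a free_alg set" where
  "box_scale q c u = box_proj q (free_const c) \<otimes>\<^bsub>box_alg q\<^esub> u"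

definition box_x :: "'a::field \<Rightarrow> 4 \<Rightarrow> 'a free_alg set" where
  "box_x q i = box_proj q (free_gen i)"

text \<open>\<open>box_n q i\<close> is the element with subscripts \<open>i, i + 1\<close>.\<close>

definition box_n :: "'a::field \<Rightarrow> 4 \<Rightarrow> 'a free_alg set" where
  "box_n q i = box_scale q (q / (q - inverse q))
     (\<one>\<^bsub>box_alg q\<^esub> \<ominus>\<^bsub>box_alg q\<^esub> box_x q i \<otimes>\<^bsub>box_alg q\<^esub> box_x q (i + 1))"

lemma free_alg_ring: "ring (ring_of_type_algebra :: 'a::field free_alg ring)"
proof (rule ringI)
  show "abelian_group (ring_of_type_algebra :: 'a free_alg ring)"
  proof (rule abelian_groupI)
    fix x :: "'a free_alg"
    show "\<exists>y\<in>carrier ring_of_type_algebra. y \<oplus>\<^bsub>ring_of_type_algebra\<^esub> x = \<zero>\<^bsub>ring_of_type_algebra\<^esub>"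
      by (rule bexI[of _ "- x"]) (simp_all add: ring_of_type_algebra_def)
  qed (simp_all add: ring_of_type_algebra_def algebra_simps)
  show "Group.monoid (ring_of_type_algebra :: 'a free_alg ring)"
    by unfold_locales (simp_all add: ring_of_type_algebra_def mult.assoc)
qed (simp_all add: ring_of_type_algebra_def algebra_simps)

lemma free_const_mult: "free_const (a * b) = free_const a * free_const b"
  using mult_single[of "[]" a "[] :: 4 list" b] by (simp add: free_const_def plus_list_def)

lemma free_const_diff: "free_const (a - b) = free_const a - free_const b"
  by (simp add: free_const_def single_diff)

lemma free_const_1: "free_const 1 = 1"
  by (simp add: free_const_def zero_list_def [symmetric])

lemma box_ideal_ideal: "ideal (box_ideal q) ring_of_type_algebra"
  unfolding box_ideal_def
  by (rule ring.genideal_ideal[OF free_alg_ring]) (simp add: ring_of_type_algebra_def)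

lemma box_alg_ring: "ring (box_alg q)"
  unfolding box_alg_def by (rule ideal.quotient_is_ring[OF box_ideal_ideal])

lemma box_proj_hom: "box_proj q \<in> ring_hom ring_of_type_algebra (box_alg q)"
  using ideal.rcos_ring_hom[OF box_ideal_ideal, of q]
  by (simp add: box_proj_def [abs_def] box_alg_def)

lemma box_proj_ring_hom: "ring_hom_ring ring_of_type_algebra (box_alg q) (box_proj q)"
  by (rule ring_hom_ringI2[OF free_alg_ring box_alg_ring box_proj_hom])

lemma box_proj_eqI:
  assumes "a - b \<in> box_ideal q"
  shows "box_proj q a = box_proj q b"
proof -
  interpret ideal "box_ideal q" "ring_of_type_algebra :: 'a free_alg ring"
    by (rule box_ideal_ideal)
  have "a \<in> box_ideal q +>\<^bsub>ring_of_type_algebra\<^esub> b"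
    unfolding a_r_coset_def' using assms
    by (force simp: ring_of_type_algebra_def intro: bexI[of _ "a - b"])
  then show ?thesis
    unfolding box_proj_def by (intro a_repr_independence[symmetric] a_subgroup)
      (auto simp: ring_of_type_algebra_def)
qed

lemma box_scale_one_minus:
  "box_scale q c (\<one>\<^bsub>box_alg q\<^esub> \<ominus>\<^bsub>box_alg q\<^esub> box_x q i \<otimes>\<^bsub>box_alg q\<^esub> box_x q j) =
   box_proj q (free_const c * (1 - free_gen i * free_gen j))"
proof -
  interpret ring_hom_ring ring_of_type_algebra "box_alg q" "box_proj q"
    by (rule box_proj_ring_hom)
  have [simp]: "carrier ring_of_type_algebra = (UNIV :: 'a free_alg set)"
    "\<one>\<^bsub>ring_of_type_algebra\<^esub> = (1 :: 'a free_alg)"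
    "a \<otimes>\<^bsub>ring_of_type_algebra\<^esub> b = a * b"
    "a \<oplus>\<^bsub>ring_of_type_algebra\<^esub> b = a + b"
    "\<zero>\<^bsub>ring_of_type_algebra\<^esub> = (0 :: 'a free_alg)" for a b :: "'a free_alg"
    by (simp_all add: ring_of_type_algebra_def)
  have neg: "\<ominus>\<^bsub>ring_of_type_algebra\<^esub> a = - a" for a :: "'a free_alg"
    by (rule R.minus_equality) simp_all
  have "box_proj q (1 - a) = \<one>\<^bsub>box_alg q\<^esub> \<ominus>\<^bsub>box_alg q\<^esub> box_proj q a" for a
    using hom_add[of 1 "- a"] hom_a_inv[of a] hom_one by (simp add: neg a_minus_def)
  then show ?thesis
    using hom_mult[of "free_gen i" "free_gen j"]
      hom_mult[of "free_const c" "1 - free_gen i * free_gen j"]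
    by (simp add: box_scale_def box_x_def)
qed

text \<open>The two expressions for the element \<open>box_n q i\<close> agree.\<close>

lemma box_n_alt:
  assumes "q \<noteq> inverse q"
  shows "box_n q i = box_scale q (inverse q / (q - inverse q))
     (\<one>\<^bsub>box_alg q\<^esub> \<ominus>\<^bsub>box_alg q\<^esub> box_x q (i + 1) \<otimes>\<^bsub>box_alg q\<^esub> box_x q i)"
proof -
  let ?d = "q - inverse q"
  have rel: "q_weyl_rel q i \<in> box_ideal q"
    unfolding box_ideal_def genideal_def by auto
  have c: "free_const (q / ?d) = free_const (1 / ?d) * free_const q"
    "free_const (inverse q / ?d) = free_const (1 / ?d) * free_const (inverse q)"
    by (simp_all flip: free_const_mult)
  have "free_const (q / ?d) - free_const (inverse q / ?d) = 1"
    using assms by (simp flip: free_const_diff diff_divide_distrib add: free_const_1)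
  then have one: "free_const (1 / ?d) * free_const q = 1 + free_const (1 / ?d) * free_const (inverse q)"
    unfolding c by (simp add: algebra_simps)
  have "free_const (inverse q / ?d) * (1 - free_gen (i + 1) * free_gen i)
      - free_const (q / ?d) * (1 - free_gen i * free_gen (i + 1)) = q_weyl_rel q i"
    unfolding q_weyl_rel_def c right_diff_distrib mult.assoc[symmetric] one
    by (simp add: algebra_simps)
  with rel show ?thesis
    unfolding box_n_def box_scale_one_minus by (intro box_proj_eqI[symmetric]) simp
qed

text \<open>A module over \<open>box_alg q\<close> is given by an algebra homomorphism into the linear endomorphisms.\<close>

locale box_module = vector_space scale
  for scale :: "'a::field \<Rightarrow> 'v::ab_group_add \<Rightarrow> 'v" +
  fixes q :: 'a and act :: "'a free_alg set \<Rightarrow> 'v \<Rightarrow> 'v"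
  assumes act_linear: "u \<in> carrier (box_alg q) \<Longrightarrow> Vector_Spaces.linear scale scale (act u)"
    and act_one: "act \<one>\<^bsub>box_alg q\<^esub> v = v"
    and act_mult: "\<lbrakk>u \<in> carrier (box_alg q); w \<in> carrier (box_alg q)\<rbrakk>
      \<Longrightarrow> act (u \<otimes>\<^bsub>box_alg q\<^esub> w) v = act u (act w v)"
    and act_add: "\<lbrakk>u \<in> carrier (box_alg q); w \<in> carrier (box_alg q)\<rbrakk>
      \<Longrightarrow> act (u \<oplus>\<^bsub>box_alg q\<^esub> w) v = act u v + act w v"
    and act_scale: "u \<in> carrier (box_alg q) \<Longrightarrow> act (box_scale q c u) v = scale c (act u v)"

text \<open>
  The sum ranges over all \<open>n\<close>; \<^const>\<open>Sum_any\<close> adds up the nonzero terms, which are finitely many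
  when \<open>\<psi>\<close> is nilpotent.
\<close>

definition exp_q :: "'a::field \<Rightarrow> ('a \<Rightarrow> 'v::ab_group_add \<Rightarrow> 'v) \<Rightarrow> ('v \<Rightarrow> 'v) \<Rightarrow> 'v \<Rightarrow> 'v" where
  "exp_q q scale \<psi> v = Sum_any (\<lambda>n. scale (q ^ (n choose 2) / q_fact q n) ((\<psi> ^^ n) v))"

end

theory Submission
  imports Defs
begin

text \<open>
  Write \<open>a\<close>, \<open>b\<close>, \<open>d\<close> for the actions of the generators with index \<open>i\<close>, \<open>i + 1\<close>, \<open>i + 3\<close>, put
  \<open>t = q\<^sup>-\<^sup>2\<close>, and let \<open>n\<close> be the action of the element with subscripts \<open>i, i + 1\<close>, so that
  \<open>a b = 1 - (1 - t) n\<close> and \<open>b a = 1 - (q\<^sup>2 - 1) n\<close>. Comparing \<open>(b a) b\<close> with \<open>b (a b)\<close> and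
  \<open>(a b) a\<close> with \<open>a (b a)\<close> gives \<open>b n = q\<^sup>2 n b\<close> and \<open>n a = q\<^sup>2 a n\<close>.

  The map \<open>n\<close> is nilpotent: applying \<open>a\<close> and \<open>b\<close> to an eigenvector multiplies the eigenvalue by
  \<open>q\<^sup>2\<close> or \<open>t\<close>, and a nonzero eigenvalue would produce infinitely many eigenvalues
  (\<open>n_no_nonzero_eigenvalue\<close>). Hence \<open>b\<close> and the q-exponential \<open>E\<close> of \<open>n\<close> are bijective. The
  functional equation of the q-exponential relates \<open>E(n)\<close> to \<open>E(t n)\<close>, which is also what \<open>E(n)\<close>
  becomes when it is moved past \<open>b\<close>; together they say that \<open>E a E\<^sup>-\<^sup>1 = b\<^sup>-\<^sup>1\<close> (\<open>b_E_a\<close>).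

  An endomorphism \<open>Z\<close> has weight \<open>r\<close> if \<open>b Z b\<^sup>-\<^sup>1 = r Z\<close>. The cubic relation between \<open>b\<close> and \<open>d\<close>
  says that conjugation by \<open>b\<close> is annihilated on \<open>d\<close> by a polynomial with the roots \<open>1\<close>, \<open>q\<^sup>2\<close>, \<open>t\<close>,
  so \<open>d\<close> is the sum of components \<open>d_zero\<close>, \<open>d_plus\<close>, \<open>d_minus\<close> of these weights
  (\<open>d_decomposition\<close>). Lagrange interpolation writes \<open>d_minus\<close> as a combination of \<open>d\<close>,
  \<open>b\<^sup>-\<^sup>1 d b\<close> and \<open>b d b\<^sup>-\<^sup>1\<close>, and the right-hand side of the theorem is exactly \<open>b + d_minus\<close>.

  Conjugating the relation between \<open>d\<close> and \<open>a\<close> by \<open>E\<close> turns it into a relation between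
  \<open>E d E\<^sup>-\<^sup>1\<close> and \<open>b\<^sup>-\<^sup>1\<close>, and this relation says precisely that \<open>Y = E d E\<^sup>-\<^sup>1 - b\<close> has weight \<open>t\<close>
  (\<open>weight_conj_d\<close>). On the other hand \<open>n\<close> has weight \<open>q\<^sup>2\<close>, so in the expansion of
  \<open>Y E = E d - b E\<close> in powers of \<open>n\<close> every term other than \<open>Y\<close> and \<open>d_minus\<close> has weight \<open>q\<^sup>2\<^sup>k\<close> with
  \<open>k \<ge> 0\<close>. As weight components are independent, \<open>Y = d_minus\<close> (\<open>conj_d\<close>), which is the theorem.
\<close>

section \<open>Polynomials in an endomorphism\<close>

text \<open>
  A name of its own for finite-dimensional vector spaces keeps the notions below apart from the
  global interpretations of the library locale.
\<close>

locale endomorphism_space = finite_dimensional_vector_space scale Basis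
  for scale :: "'a::field \<Rightarrow> 'v::ab_group_add \<Rightarrow> 'v" and Basis :: "'v set"
begin

abbreviation lin :: "('v \<Rightarrow> 'v) \<Rightarrow> bool" where
  "lin \<equiv> module_hom scale scale"

lemmas lin_simps = module_hom.zero[of scale scale] module_hom.add[of scale scale]
  module_hom.neg[of scale scale] module_hom.diff[of scale scale]
  module_hom.scale[of scale scale] module_hom.sum[of scale scale]

lemma linI:
  assumes "\<And>v w. f (v + w) = f v + f w" and "\<And>c v. f (scale c v) = scale c (f v)"
  shows "lin f"
  using assms by unfold_locales (simp_all add: algebra_simps)

lemma lin_funpow: "lin f \<Longrightarrow> lin (f ^^ k)"
  by (induction k) (auto intro!: linI simp: lin_simps)

lemma lin_sum: "(\<And>k. k \<in> I \<Longrightarrow> lin (f k)) \<Longrightarrow> lin (\<lambda>v. \<Sum>k\<in>I. f k v)"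
  by (rule linI) (simp_all add: lin_simps sum.distrib scale_sum_right)

lemma lin_scaled: "lin f \<Longrightarrow> lin (\<lambda>v. scale c (f v))"
  by (rule linI) (simp_all add: lin_simps scale_right_distrib mult.commute)

definition poly_at :: "('v \<Rightarrow> 'v) \<Rightarrow> 'a poly \<Rightarrow> 'v \<Rightarrow> 'v" where
  "poly_at f p v = (\<Sum>k\<le>degree p. scale (coeff p k) ((f ^^ k) v))"

lemma poly_at_altdef:
  assumes "degree p \<le> m"
  shows "poly_at f p v = (\<Sum>k\<le>m. scale (coeff p k) ((f ^^ k) v))"
  unfolding poly_at_def using assms
  by (intro sum.mono_neutral_left) (auto simp: coeff_eq_0)

lemma poly_at_0 [simp]: "poly_at f 0 v = 0"
  by (simp add: poly_at_def)

lemma lin_poly_at: "lin f \<Longrightarrow> lin (poly_at f p)"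
  unfolding poly_at_def by (intro lin_sum lin_scaled lin_funpow)

lemma poly_at_pCons:
  assumes "lin f"
  shows "poly_at f (pCons c p) v = scale c v + f (poly_at f p v)"
proof -
  have "poly_at f (pCons c p) v = (\<Sum>k\<le>Suc (degree p). scale (coeff (pCons c p) k) ((f ^^ k) v))"
    by (rule poly_at_altdef) (rule degree_pCons_le)
  also have "\<dots> = scale c v + f (poly_at f p v)"
    using assms by (subst sum.atMost_Suc_shift) (simp add: poly_at_def lin_simps)
  finally show ?thesis .
qed

lemma poly_at_add: "poly_at f (p + r) v = poly_at f p v + poly_at f r v"
  using poly_at_altdef[of p "max (degree p) (degree r)" f v]
    poly_at_altdef[of r "max (degree p) (degree r)" f v]
    poly_at_altdef[of "p + r" "max (degree p) (degree r)" f v]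
  by (simp add: degree_add_le scale_left_distrib sum.distrib)

lemma poly_at_smult: "poly_at f (smult c p) v = scale c (poly_at f p v)"
  using poly_at_altdef[of "smult c p" "degree p" f v]
  by (simp add: poly_at_def degree_smult_le scale_sum_right)

lemma poly_at_mult:
  assumes "lin f"
  shows "poly_at f (p * r) v = poly_at f p (poly_at f r v)"
  by (induction p) (simp_all add: poly_at_add poly_at_smult poly_at_pCons[OF assms])

lemma poly_at_sum: "poly_at f (sum p I) v = (\<Sum>k\<in>I. poly_at f (p k) v)"
  by (induction I rule: infinite_finite_induct) (simp_all add: poly_at_add)

lemma poly_at_monom: "poly_at f (monom c k) v = scale c ((f ^^ k) v)"
proof -
  have "poly_at f (monom c k) v = (\<Sum>j\<le>k. scale (coeff (monom c k) j) ((f ^^ j) v))"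
    by (rule poly_at_altdef) (rule degree_monom_le)
  also have "\<dots> = (\<Sum>j\<le>k. if j = k then scale c ((f ^^ k) v) else 0)"
    by (intro sum.cong) auto
  finally show ?thesis by simp
qed

lemma poly_at_eigenvector:
  assumes "lin f" "f v = scale l v"
  shows "poly_at f p v = scale (poly p l) v"
  by (induction p) (simp_all add: poly_at_pCons lin_simps assms scale_left_distrib mult.commute)

text \<open>
  Removing the linear factors of \<open>p\<close> one by one: a factor with nonzero root is injective and can be
  cancelled, and each factor with root \<open>0\<close> costs one application of \<open>f\<close>.
\<close>

lemma nilpotent_if_no_nonzero_eigenvalue:
  fixes p :: "'a poly"
  assumes "lin f" and roots: "\<And>p :: 'a poly. degree p > 0 \<Longrightarrow> \<exists>x. poly p x = 0"
    and eig: "\<And>l v. l \<noteq> 0 \<Longrightarrow> f v = scale l v \<Longrightarrow> v = 0"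
    and "p \<noteq> 0" "poly_at f p v = 0"
  shows "(f ^^ degree p) v = 0"
  using assms(4,5)
proof (induction "degree p" arbitrary: p v)
  case 0
  then obtain c where "p = [:c:]" "c \<noteq> 0"
    by (metis degree_eq_zeroE pCons_0_0)
  with 0 show ?case by (simp add: poly_at_pCons[OF assms(1)] lin_simps assms(1))
next
  case (Suc m)
  then obtain l where "poly p l = 0"
    using roots[of p] by auto
  then obtain r where r: "p = [:- l, 1:] * r"
    by (metis poly_eq_0_iff_dvd dvdE)
  have r0: "r \<noteq> 0" using Suc r by auto
  then have deg: "degree r = m"
    using Suc(2) r by (simp add: degree_mult_eq del: mult_pCons_left)
  have lr: "f (poly_at f r v) = scale l (poly_at f r v)"
    using Suc.prems(2) unfolding r poly_at_mult[OF assms(1)]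
    by (simp add: poly_at_pCons[OF assms(1)] lin_simps assms(1))
  show ?case
  proof (cases "l = 0")
    case False
    then have "poly_at f r v = 0" using eig lr by blast
    then have "(f ^^ m) v = 0" using Suc.hyps(1)[OF _ r0] deg by auto
    then show ?thesis using assms(1) by (simp flip: Suc.hyps(2) add: lin_simps)
  next
    case True
    have "poly_at f r (f v) = f (poly_at f r v)"
      using assms(1)
      by (simp add: poly_at_def lin_simps flip: funpow_swap1)
    then have "poly_at f r (f v) = 0" using lr True by simp
    then have "(f ^^ m) (f v) = 0" using Suc.hyps(1)[OF _ r0] deg by auto
    then show ?thesis by (simp flip: Suc.hyps(2) add: funpow_swap1)
  qed
qed

text \<open>
  The \<open>dimension + 1\<close> vectors \<open>(f ^^ k) v\<close> with \<open>k \<le> dimension\<close> either repeat or are linearly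
  dependent; either way a polynomial can be read off.
\<close>

lemma annihilating_poly_at_vector:
  assumes "lin f"
  shows "\<exists>p. p \<noteq> 0 \<and> poly_at f p v = 0"
proof (cases "inj_on (\<lambda>k. (f ^^ k) v) {..dimension}")
  case False
  then obtain i j where "i \<noteq> j" "(f ^^ i) v = (f ^^ j) v"
    by (auto simp: inj_on_def)
  then obtain i j where ij: "i < j" "(f ^^ i) v = (f ^^ j) v"
    by (cases i j rule: linorder_cases) auto
  have "monom (- 1) i + monom 1 j \<noteq> (0 :: 'a poly)"
    using ij(1) by (auto simp: poly_eq_iff coeff_monom intro!: exI[of _ j])
  moreover have "poly_at f (monom (- 1) i + monom 1 j) v = 0"
    using ij(2) by (simp add: poly_at_add poly_at_monom)
  ultimately show ?thesis by blast
next
  case inj: True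
  let ?S = "(\<lambda>k. (f ^^ k) v) ` {..dimension}"
  have "card ?S = Suc dimension" using inj by (simp add: card_image)
  then have "dependent ?S"
    using independent_bound_general[of ?S] dim_subset_UNIV[of ?S] by force
  then obtain u where u: "\<exists>w\<in>?S. u w \<noteq> 0" "(\<Sum>w\<in>?S. scale (u w) w) = 0"
    by (auto simp: dependent_finite)
  define p where "p = (\<Sum>k\<le>dimension. monom (u ((f ^^ k) v)) k)"
  obtain k where "k \<le> dimension" "u ((f ^^ k) v) \<noteq> 0" using u(1) by auto
  moreover from this have "coeff p k = u ((f ^^ k) v)"
    by (simp add: p_def coeff_sum coeff_monom)
  ultimately have "p \<noteq> 0" by auto
  moreover have "poly_at f p v = 0"
    using u(2) sum.reindex[OF inj, of "\<lambda>w. scale (u w) w"]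
    by (simp add: p_def poly_at_sum poly_at_monom)
  ultimately show ?thesis by blast
qed

text \<open>
  The product of annihilating polynomials for the basis vectors kills every basis vector, since
  polynomials in \<open>f\<close> commute.
\<close>

lemma annihilating_poly:
  assumes "lin f"
  shows "\<exists>p. p \<noteq> 0 \<and> (\<forall>v. poly_at f p v = 0)"
proof -
  have "\<exists>p. p \<noteq> 0 \<and> (\<forall>v\<in>S. poly_at f p v = 0)" if "finite S" for S
    using that
  proof induction
    case empty
    then show ?case by (intro exI[of _ 1]) simp
  next
    case (insert w S)
    then obtain p where p: "p \<noteq> 0" "\<forall>v\<in>S. poly_at f p v = 0" by blast
    obtain r where r: "r \<noteq> 0" "poly_at f r w = 0"
      using annihilating_poly_at_vector[OF assms] by blast
    have "poly_at f (r * p) v = 0" if "v \<in> insert w S" for v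
    proof -
      have "poly_at f (r * p) v = poly_at f r (poly_at f p v)"
        "poly_at f (r * p) v = poly_at f p (poly_at f r v)"
        using poly_at_mult[OF assms] by (metis mult.commute)+
      moreover have "poly_at f p v = 0 \<or> poly_at f r v = 0"
        using that p(2) r(2) by blast
      ultimately show ?thesis
        by (auto simp: lin_simps lin_poly_at[OF assms])
    qed
    then show ?case using p r by (intro exI[of _ "r * p"]) auto
  qed
  then obtain p where p: "p \<noteq> 0" "\<forall>v\<in>Basis. poly_at f p v = 0"
    using finite_Basis by blast
  have "poly_at f p v = 0" for v
    using p(2) span_Basis module_hom.eq_0_on_span[OF lin_poly_at[OF assms, of p], of Basis v] by auto
  with p show ?thesis by blast
qed

lemma lin_inj_imp_bij:
  assumes "lin f" and "\<And>v. f v = 0 \<Longrightarrow> v = 0"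
  shows "bij f"
proof -
  have l: "Vector_Spaces.linear scale scale f"
    using assms(1) by (simp add: linear_iff_module_hom)
  have "inj f" using assms module_hom.inj_iff_eq_0[OF assms(1)] by blast
  with linear_inj_imp_surj[OF l] show ?thesis by (simp add: bij_def)
qed

end

section \<open>Nilpotency from one q-Weyl relation\<close>

text \<open>
  The maps \<open>a\<close> and \<open>b\<close> model the actions of two consecutive generators.
\<close>

locale q_weyl_pair = endomorphism_space scale Basis
  for scale :: "'a::alg_closed_field \<Rightarrow> 'v::ab_group_add \<Rightarrow> 'v" and Basis :: "'v set" +
  fixes q :: 'a and a b :: "'v \<Rightarrow> 'v"
  assumes q_nonzero: "q \<noteq> 0"
    and q_not_root_of_unity: "\<And>k::nat. k > 0 \<Longrightarrow> q ^ k \<noteq> 1"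
    and lin_a: "lin a" and lin_b: "lin b"
    and weyl: "scale q (a (b v)) - scale (inverse q) (b (a v)) = scale (q - inverse q) v"
begin

definition n :: "'v \<Rightarrow> 'v" where
  "n v = scale (q / (q - inverse q)) (v - a (b v))"

abbreviation t :: 'a where "t \<equiv> inverse (q^2)"

lemma lin_n: "lin n"
  by (rule linI) (simp_all add: n_def lin_simps lin_a lin_b scale_right_diff_distrib
      scale_right_distrib mult.commute)

lemmas lin_abn = lin_simps lin_a lin_b lin_n lin_funpow

lemma q_power_eq_1: "q ^ k = 1 \<longleftrightarrow> k = 0"
  using q_not_root_of_unity[of k] by (cases "k = 0") auto

lemma t_power_eq_1: "t ^ k = 1 \<longleftrightarrow> k = 0"
  using q_power_eq_1[of "2 * k"] by (simp add: power_inverse power_mult)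

lemma q_minus_inverse: "q - inverse q \<noteq> 0" "q^2 - 1 \<noteq> 0" "q^2 - inverse (q^2) \<noteq> 0" "t \<noteq> 1"
  using q_power_eq_1[of 2] q_power_eq_1[of 4] q_nonzero
  by (auto simp: field_simps power2_eq_square power4_eq_xxxx)

lemma ab_eq: "a (b v) = v - scale (1 - t) (n v)"
proof -
  have "(1 - t) * (q / (q - inverse q)) = 1"
    using q_nonzero q_minus_inverse by (simp add: field_simps power2_eq_square)
  then show ?thesis by (simp add: n_def)
qed

lemma ba_eq: "b (a v) = v - scale (q^2 - 1) (n v)"
proof -
  have "scale (inverse q) (b (a v)) = scale q (a (b v)) - scale (q - inverse q) v"
    using weyl[of v] by (simp add: algebra_simps)
  also have "\<dots> = scale (inverse q) v - scale (q * (1 - t)) (n v)"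
    by (simp add: ab_eq scale_right_diff_distrib scale_left_diff_distrib right_diff_distrib)
  also have "\<dots> = scale (inverse q) (v - scale (q^2 - 1) (n v))"
    using q_nonzero
    by (simp add: scale_right_diff_distrib) (simp add: field_simps power2_eq_square)
  finally show ?thesis using q_nonzero by simp
qed

lemma bn_eq: "b (n v) = scale (q^2) (n (b v))"
proof -
  have "scale (1 - t) (b (n v)) = scale (q^2 - 1) (n (b v))"
    using ba_eq[of "b v"] by (simp add: ab_eq lin_abn)
  also have "\<dots> = scale (1 - t) (scale (q^2) (n (b v)))"
    unfolding scale_scale
    by (rule arg_cong[of _ _ "\<lambda>c. scale c _"]) (use q_nonzero in \<open>simp add: field_simps\<close>)
  finally show ?thesis using q_minus_inverse(4) by (simp del: scale_scale)
qed

lemma na_eq: "n (a v) = scale (q^2) (a (n v))"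
proof -
  have "scale (1 - t) (n (a v)) = scale (q^2 - 1) (a (n v))"
    using ab_eq[of "a v"] by (simp add: ba_eq lin_abn)
  also have "\<dots> = scale (1 - t) (scale (q^2) (a (n v)))"
    unfolding scale_scale
    by (rule arg_cong[of _ _ "\<lambda>c. scale c _"]) (use q_nonzero in \<open>simp add: field_simps\<close>)
  finally show ?thesis using q_minus_inverse(4) by (simp del: scale_scale)
qed

lemma nb_eq: "n (b v) = scale t (b (n v))"
  using q_nonzero by (simp add: bn_eq)

lemma n_funpow_b: "(n ^^ k) (b v) = scale (t ^ k) (b ((n ^^ k) v))"
  by (induction k) (simp_all add: lin_abn nb_eq mult.commute)

lemma b_n_funpow: "b ((n ^^ k) v) = scale ((q^2) ^ k) ((n ^^ k) (b v))"
  by (induction k) (simp_all add: lin_abn bn_eq mult.commute)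

text \<open>
  The scalars \<open>c * r ^ k\<close> are pairwise distinct, and an annihilating polynomial of \<open>n\<close> has only
  finitely many roots, so not all \<open>w k\<close> can be eigenvectors.
\<close>

lemma no_geometric_eigenvalues:
  assumes "c \<noteq> 0" "r \<noteq> 0" and r: "\<And>k. r ^ k = 1 \<longleftrightarrow> k = 0"
    and "\<And>k. n (w k) = scale (c * r ^ k) (w k)"
  shows "\<exists>k::nat. w k = 0"
proof (rule ccontr)
  assume nz: "\<nexists>k. w k = 0"
  obtain p where p: "p \<noteq> 0" "\<And>v. poly_at n p v = 0"
    using annihilating_poly[OF lin_n] by blast
  have "poly p (c * r ^ k) = 0" for k
    using poly_at_eigenvector[OF lin_n assms(4)[of k], of p] p(2)[of "w k"] nz by simp
  then have "range (\<lambda>k. c * r ^ k) \<subseteq> {x. poly p x = 0}" by auto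
  then have "finite (range (\<lambda>k. c * r ^ k))"
    using poly_roots_finite[OF p(1)] finite_subset by blast
  moreover have "inj (\<lambda>k. c * r ^ k)"
  proof (rule linorder_injI)
    fix k m :: nat assume "k < m"
    have "r ^ m \<noteq> r ^ k"
      using r[of "m - k"] \<open>k < m\<close> \<open>r \<noteq> 0\<close> by (simp add: power_diff field_simps)
    then show "c * r ^ k \<noteq> c * r ^ m" using \<open>c \<noteq> 0\<close> by auto
  qed
  ultimately show False using finite_imageD infinite_UNIV_nat by blast
qed

text \<open>
  Applying \<open>a\<close> repeatedly to an eigenvector must eventually give \<open>0\<close>; the last nonzero vector \<open>w\<close>
  is killed by \<open>a\<close>, and \<open>b a = 1 - (q\<^sup>2 - 1) n\<close> forces its eigenvalue to be \<open>1 / (q\<^sup>2 - 1)\<close>. From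
  \<open>w\<close> one then climbs with \<open>b\<close>: on \<open>(b ^^ j) w\<close> the map \<open>a b\<close> is the scalar \<open>1 - t ^ (j + 1)\<close>,
  which is nonzero as \<open>q\<close> is not a root of unity, so this chain of eigenvectors never ends.
\<close>

lemma n_no_nonzero_eigenvalue:
  assumes "l \<noteq> 0" and nv: "n v = scale l v"
  shows "v = 0"
proof (rule ccontr)
  assume "v \<noteq> 0"
  have eig: "n ((a ^^ k) v) = scale (l * (q^2) ^ k) ((a ^^ k) v)" for k
    by (induction k) (simp_all add: nv na_eq lin_abn mult_ac)
  have "\<exists>k. (a ^^ k) v = 0"
    using q_power_eq_1[of "2 * _"] q_nonzero
    by (intro no_geometric_eigenvalues[OF \<open>l \<noteq> 0\<close> _ _ eig]) (simp_all flip: power_mult)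
  then obtain m where m: "(a ^^ m) v = 0" "\<And>k. k < m \<Longrightarrow> (a ^^ k) v \<noteq> 0"
    using exists_least_iff[of "\<lambda>k. (a ^^ k) v = 0"] by auto
  then obtain k where k: "m = Suc k" using \<open>v \<noteq> 0\<close> by (cases m) auto
  define w where "w = (a ^^ k) v"
  have w: "w \<noteq> 0" "a w = 0" using m k by (auto simp: w_def)
  define c where "c = inverse (q^2 - 1)"
  have c0: "c \<noteq> 0" using q_minus_inverse by (simp add: c_def)
  have "scale (q^2 - 1) (n w) = w" using ba_eq[of w] w by (simp add: lin_abn)
  then have "n w = scale c w"
    using q_minus_inverse unfolding c_def by (metis left_inverse scale_one scale_scale)
  then have eigb: "n ((b ^^ j) w) = scale (c * t ^ j) ((b ^^ j) w)" for j
    by (induction j) (simp_all add: nb_eq lin_abn mult_ac)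
  have "(1 - t) * c = t"
    using q_nonzero q_minus_inverse by (simp add: c_def field_simps)
  then have ab: "a (b ((b ^^ j) w)) = scale (1 - t ^ Suc j) ((b ^^ j) w)" for j
    using arg_cong[of "(1 - t) * c" t "\<lambda>x. x * t ^ j"]
    by (simp add: ab_eq eigb scale_left_diff_distrib mult.assoc)
  have "(b ^^ j) w \<noteq> 0" for j
  proof (induction j)
    case (Suc j)
    have "a (b ((b ^^ j) w)) \<noteq> 0"
      using Suc t_power_eq_1[of "Suc j"] unfolding ab by simp
    then show ?case using lin_a by (auto simp: lin_abn)
  qed (simp add: w)
  moreover have "\<exists>j. (b ^^ j) w = 0"
    using q_nonzero by (intro no_geometric_eigenvalues[OF c0 _ t_power_eq_1 eigb]) simp
  ultimately show False by blast
qed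

lemma n_nilpotent: "\<exists>m. \<forall>v. (n ^^ m) v = 0"
proof -
  obtain p where p: "p \<noteq> 0" "\<And>v. poly_at n p v = 0"
    using annihilating_poly[OF lin_n] by blast
  have "(n ^^ degree p) v = 0" for v
    using n_no_nonzero_eigenvalue alg_closed_imp_poly_has_root p
    by (intro nilpotent_if_no_nonzero_eigenvalue[OF lin_n]) auto
  then show ?thesis by blast
qed

text \<open>
  \<open>a b = 1 - (1 - t) n\<close> is unipotent: a vector in the kernel of \<open>b\<close> is a multiple of its own image
  under every power of \<open>n\<close>.
\<close>

lemma bij_b: "bij b"
proof (rule lin_inj_imp_bij[OF lin_b])
  fix v assume "b v = 0"
  then have "v = scale (1 - t) (n v)" using ab_eq[of v] by (simp add: lin_abn)
  then have "\<exists>c. v = scale c ((n ^^ k) v)" for k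
  proof (induction k)
    case 0
    then show ?case by (intro exI[of _ 1]) simp
  next
    case (Suc k)
    then obtain c where "v = scale c ((n ^^ k) v)" by blast
    also have "(n ^^ k) v = (n ^^ k) (scale (1 - t) (n v))" using Suc(2) by simp
    also have "\<dots> = scale (1 - t) ((n ^^ Suc k) v)"
      by (simp add: lin_abn funpow_swap1)
    finally show ?case by auto
  qed
  then show "v = 0" using n_nilpotent by (metis scale_zero_right)
qed

section \<open>The q-exponential of n\<close>

definition ecoeff :: "nat \<Rightarrow> 'a" where
  "ecoeff k = q ^ (k choose 2) / q_fact q k"

lemma ecoeff_0: "ecoeff 0 = 1"
  by (simp add: ecoeff_def q_fact_def numeral_2_eq_2)

text \<open>
  This recurrence of the coefficients is the functional equation
  \<open>E(t n) = E(n) (1 - (1 - t) n)\<close> of the q-exponential, read off power by power.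
\<close>

lemma ecoeff_Suc: "ecoeff (Suc k) * (1 - t ^ Suc k) = ecoeff k * (1 - t)"
proof -
  define h where "h = q - inverse q"
  have h0: "h \<noteq> 0" using q_minus_inverse by (simp add: h_def)
  define x where "x = 1 - t ^ Suc k"
  have x0: "x \<noteq> 0" using t_power_eq_1[of "Suc k"] by (simp add: x_def)
  have "q_int q (int (Suc k)) = (q ^ Suc k - inverse q ^ Suc k) / h"
    unfolding q_int_def h_def power_int_minus power_int_of_nat power_inverse ..
  also have "inverse q ^ Suc k = q ^ Suc k * t ^ Suc k"
    using q_nonzero
    by (subst power_mult_distrib[symmetric])
      (simp add: power2_eq_square mult.assoc[symmetric] del: power_Suc)
  finally have qi: "q_int q (int (Suc k)) = q ^ Suc k * x / h"
    by (simp add: x_def algebra_simps del: power_Suc)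
  have "ecoeff (Suc k) = q ^ k * ecoeff k / q_int q (int (Suc k))"
    by (simp add: ecoeff_def q_fact_def numeral_2_eq_2 power_add)
  then have "ecoeff (Suc k) * x = ecoeff k * (h / q)"
    using h0 x0 q_nonzero unfolding qi by simp
  also have "h / q = 1 - t"
    using q_nonzero by (simp add: h_def field_simps power2_eq_square)
  finally show ?thesis unfolding x_def .
qed

abbreviation E :: "'v \<Rightarrow> 'v" where "E \<equiv> exp_q q scale n"

lemma n_funpow_above:
  assumes "\<And>v. (n ^^ m) v = 0" "m \<le> k"
  shows "(n ^^ k) v = 0"
  using assms(1)[of "(n ^^ (k - m)) v"] assms(2) by (simp flip: funpow_add comp_apply[of "n ^^ m"])

lemma E_eq_sum:
  assumes "\<And>v. (n ^^ m) v = 0"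
  shows "E v = (\<Sum>k<m. scale (ecoeff k) ((n ^^ k) v))"
  unfolding exp_q_def ecoeff_def[symmetric]
  by (rule Sum_any.expand_superset)
    (use n_funpow_above[OF assms] in \<open>auto simp: not_less[symmetric]\<close>)

lemma lin_E: "lin E"
proof -
  obtain m where m: "\<And>v. (n ^^ m) v = 0" using n_nilpotent by blast
  then have "E = (\<lambda>v. \<Sum>k<m. scale (ecoeff k) ((n ^^ k) v))"
    by (intro ext E_eq_sum)
  then show ?thesis by (simp only:) (intro lin_sum lin_scaled lin_funpow lin_n)
qed

text \<open>
  If \<open>n ^^ i\<close> is the highest power of \<open>n\<close> that does not kill \<open>v\<close>, then applying it to \<open>E v\<close> leaves
  only the constant term, \<open>(n ^^ i) v\<close>.
\<close>

lemma bij_E: "bij E"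
proof (rule lin_inj_imp_bij[OF lin_E], rule ccontr)
  fix v assume v: "E v = 0" "v \<noteq> 0"
  obtain m where m: "\<And>v. (n ^^ m) v = 0" using n_nilpotent by blast
  obtain j where j: "(n ^^ j) v = 0" "\<And>k. k < j \<Longrightarrow> (n ^^ k) v \<noteq> 0"
    using m[of v] exists_least_iff[of "\<lambda>k. (n ^^ k) v = 0"] by auto
  then obtain i where i: "j = Suc i" using v by (cases j) auto
  have above: "(n ^^ i) ((n ^^ k) v) = 0" if "k > 0" for k
  proof -
    have "(n ^^ i) ((n ^^ k) v) = (n ^^ (k - 1)) ((n ^^ j) v)"
      using that i unfolding comp_apply[symmetric, of "n ^^ _" "n ^^ _"] funpow_add[symmetric]
      by (simp add: add.commute)
    then show ?thesis using j(1) by (simp add: lin_abn)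
  qed
  have "m > 0" using m[of v] v(2) by (cases m) auto
  then have "0 = (n ^^ i) (\<Sum>k<Suc (m - 1). scale (ecoeff k) ((n ^^ k) v))"
    using v(1) E_eq_sum[OF m, of v] by (simp add: lin_abn)
  also have "\<dots> = (n ^^ i) v"
    by (subst sum.lessThan_Suc_shift) (simp add: lin_abn above ecoeff_0 del: funpow.simps)
  finally show False using j(2)[of i] i by simp
qed

text \<open>
  The right-hand side is \<open>E(t n) v\<close>, so this is the functional equation for the factor
  \<open>a b = 1 - (1 - t) n\<close>.
\<close>

lemma E_ab:
  assumes "\<And>v. (n ^^ m) v = 0"
  shows "E (a (b v)) = (\<Sum>k<m. scale (ecoeff k * t ^ k) ((n ^^ k) v))"
proof (cases m)
  case 0
  then show ?thesis using E_eq_sum[OF assms] by simp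
next
  case (Suc l)
  let ?S = "\<lambda>f :: nat \<Rightarrow> 'a. \<Sum>k<l. scale (f k) ((n ^^ Suc k) v)"
  have Ev: "E v = v + ?S (\<lambda>k. ecoeff (Suc k))"
    unfolding E_eq_sum[OF assms] Suc
    by (subst sum.lessThan_Suc_shift) (simp add: ecoeff_0)
  have En: "E (n v) = ?S ecoeff"
    unfolding E_eq_sum[OF assms] Suc
    using assms[of v] by (simp add: Suc funpow_swap1)
  have "ecoeff (Suc k) - (1 - t) * ecoeff k = ecoeff (Suc k) * t ^ Suc k" for k
    using ecoeff_Suc[of k] by (simp add: algebra_simps)
  then have "?S (\<lambda>k. ecoeff (Suc k)) - scale (1 - t) (?S ecoeff)
      = ?S (\<lambda>k. ecoeff (Suc k) * t ^ Suc k)"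
    by (simp add: scale_sum_right flip: sum_subtractf scale_left_diff_distrib
        del: funpow.simps power_Suc)
  then have "E (a (b v)) = v + ?S (\<lambda>k. ecoeff (Suc k) * t ^ Suc k)"
    by (simp add: ab_eq lin_simps lin_E Ev En del: funpow.simps power_Suc)
  also have "\<dots> = (\<Sum>k<m. scale (ecoeff k * t ^ k) ((n ^^ k) v))"
    unfolding Suc by (subst sum.lessThan_Suc_shift) (simp add: ecoeff_0 del: funpow.simps)
  finally show ?thesis .
qed

text \<open>
  This is \<open>E a E\<^sup>-\<^sup>1 = b\<^sup>-\<^sup>1\<close>: moving \<open>E(n)\<close> past \<open>b\<close> gives \<open>E(n) b = b E(t n) = b E(n) a b\<close>, and the
  surjective factor \<open>b\<close> on the right can be cancelled.
\<close>

lemma b_E_a: "b (E (a v)) = E v"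
proof -
  obtain w where w: "v = b w" using bij_b by (metis bij_pointE)
  obtain m where m: "\<And>v. (n ^^ m) v = 0" using n_nilpotent by blast
  show ?thesis
    unfolding w E_ab[OF m] unfolding E_eq_sum[OF m] by (simp add: lin_abn n_funpow_b)
qed

section \<open>Weights with respect to conjugation by b\<close>

text \<open>
  As \<open>b\<close> is bijective, this is the eigenvalue equation \<open>b Z b\<^sup>-\<^sup>1 = r Z\<close>, in a form that
  avoids the inverse.
\<close>

definition weight :: "'a \<Rightarrow> ('v \<Rightarrow> 'v) \<Rightarrow> bool" where
  "weight r Z \<longleftrightarrow> (\<forall>v. b (Z v) = scale r (Z (b v)))"

lemma weight_diff: "weight r Y \<Longrightarrow> weight r Z \<Longrightarrow> weight r (\<lambda>v. Y v - Z v)"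
  by (simp add: weight_def lin_abn scale_right_diff_distrib)

lemma weight_scale: "weight r Z \<Longrightarrow> weight r (\<lambda>v. scale c (Z v))"
  by (simp add: weight_def lin_abn mult.commute)

lemma weight_comp: "weight r Y \<Longrightarrow> weight s Z \<Longrightarrow> lin Y \<Longrightarrow> weight (r * s) (\<lambda>v. Y (Z v))"
  by (simp add: weight_def lin_simps)

lemma weight_b: "weight 1 b"
  by (simp add: weight_def)

lemma weight_n_funpow: "weight ((q^2) ^ k) (n ^^ k)"
  by (simp add: weight_def b_n_funpow)

text \<open>
  Eigenvectors of conjugation by \<open>b\<close> with an eigenvalue \<open>r\<close> are independent of those with other
  eigenvalues. The induction removes one summand \<open>Z j\<close> at a time by applying conjugation by \<open>b\<close>
  minus \<open>s j\<close>, which multiplies \<open>U\<close> by the nonzero scalar \<open>r - s j\<close>.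
\<close>

lemma weight_not_in_sum_imp_zero:
  assumes "finite I" and "weight r U" and "\<And>k. k \<in> I \<Longrightarrow> weight (s k) (Z k)"
    and "\<And>k. k \<in> I \<Longrightarrow> s k \<noteq> r" and "\<And>v. U v = (\<Sum>k\<in>I. Z k v)"
  shows "U v = 0"
  using assms
proof (induction I arbitrary: U Z v)
  case (insert j I)
  define U' where "U' = (\<lambda>v. scale (r - s j) (U (b v)))"
  define Z' where "Z' = (\<lambda>k v. scale (s k - s j) (Z k (b v)))"
  have bU: "b (U v) = scale r (U (b v))" for v
    using insert.prems(1) by (simp add: weight_def)
  have bZ: "b (Z k v) = scale (s k) (Z k (b v))" if "k \<in> insert j I" for k v
    using insert.prems(2)[OF that] by (simp add: weight_def)
  have "U' v = (\<Sum>k\<in>I. Z' k v)" for v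
  proof -
    have "U' v = b (U v) - scale (s j) (U (b v))"
      by (simp add: U'_def bU scale_left_diff_distrib)
    also have "\<dots> = (\<Sum>k\<in>insert j I. Z' k v)"
      unfolding insert.prems(4) Z'_def
      by (simp add: lin_abn bZ scale_sum_right scale_left_diff_distrib flip: sum_subtractf
          del: sum.insert)
    also have "\<dots> = (\<Sum>k\<in>I. Z' k v)"
      using insert.hyps by (simp add: Z'_def)
    finally show ?thesis .
  qed
  moreover have "weight r U'"
    by (simp add: weight_def U'_def bU lin_abn mult.commute)
  moreover have "weight (s k) (Z' k)" if "k \<in> I" for k
    using that by (simp add: weight_def Z'_def bZ lin_abn mult.commute)
  ultimately have "U' w = 0" for w
    using insert.IH[of U' Z'] insert.prems(3) by blast
  then have "U (b w) = 0" for w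
    using insert.prems(3)[of j] by (auto simp: U'_def)
  then show ?case using bij_b by (metis bij_pointE)
qed simp

definition nonneg_weights :: "('v \<Rightarrow> 'v) \<Rightarrow> bool" where
  "nonneg_weights U \<longleftrightarrow> (\<exists>m Z. (\<forall>k. weight ((q^2) ^ k) (Z k)) \<and> (\<forall>v. U v = (\<Sum>k<m::nat. Z k v)))"

lemma nonneg_weights_single:
  assumes "weight ((q^2) ^ k) U"
  shows "nonneg_weights U"
proof -
  have "weight ((q^2) ^ j) (if j = k then U else (\<lambda>_. 0))" for j
    using assms by (simp add: weight_def lin_abn)
  moreover have "U v = (\<Sum>j<Suc k. (if j = k then U else (\<lambda>_. 0)) v)" for v
    by (subst sum.cong[OF refl, of _ _ "\<lambda>j. if j = k then U v else 0"]) auto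
  ultimately show ?thesis
    unfolding nonneg_weights_def
    by (intro exI[of _ "Suc k"] exI[of _ "\<lambda>j. if j = k then U else (\<lambda>_. 0)"]) blast
qed

lemma nonneg_weights_add:
  assumes "nonneg_weights U" "nonneg_weights Y"
  shows "nonneg_weights (\<lambda>v. U v + Y v)"
proof -
  from assms obtain m1 Z1 m2 Z2
    where Z1: "\<And>k. weight ((q^2) ^ k) (Z1 k)" "\<And>v. U v = (\<Sum>k<m1::nat. Z1 k v)"
      and Z2: "\<And>k. weight ((q^2) ^ k) (Z2 k)" "\<And>v. Y v = (\<Sum>k<m2::nat. Z2 k v)"
    unfolding nonneg_weights_def by metis
  define Z where "Z k v = (if k < m1 then Z1 k v else 0) + (if k < m2 then Z2 k v else 0)" for k v
  have "weight ((q^2) ^ k) (Z k)" for k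
    using Z1(1)[of k] Z2(1)[of k]
    by (simp add: Z_def weight_def lin_abn scale_right_distrib)
  moreover have "U v + Y v = (\<Sum>k<max m1 m2. Z k v)" for v
  proof -
    have *: "(\<Sum>k<max m1 m2. if k < m then f k else 0) = sum f {..<m}"
      if "m \<le> max m1 m2" for m and f :: "nat \<Rightarrow> 'v"
      using that by (intro sum.mono_neutral_cong_right) auto
    show ?thesis unfolding Z_def sum.distrib Z1(2) Z2(2) by (simp add: *)
  qed
  ultimately show ?thesis unfolding nonneg_weights_def by blast
qed

lemma nonneg_weights_sum:
  "(\<And>k. k \<in> I \<Longrightarrow> nonneg_weights (U k)) \<Longrightarrow> nonneg_weights (\<lambda>v. \<Sum>k\<in>I. U k v)"
proof (induction I rule: infinite_finite_induct)
  case (insert x F)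
  then show ?case using nonneg_weights_add[of "U x" "\<lambda>v. \<Sum>k\<in>F. U k v"] by simp
qed (auto intro: nonneg_weights_single[of 0] simp: weight_def lin_abn)

text \<open>
  None of the weights \<open>q\<^sup>2\<^sup>k\<close> with \<open>k \<ge> 0\<close> equals \<open>t\<close>, because \<open>q\<close> is not a root of unity.
\<close>

lemma nonneg_weights_and_weight_t_imp_zero:
  assumes "nonneg_weights U" "weight t U"
  shows "U v = 0"
proof -
  obtain m Z where Z: "\<And>k. weight ((q^2) ^ k) (Z k)" "\<And>v. U v = (\<Sum>k<m::nat. Z k v)"
    using assms(1) unfolding nonneg_weights_def by metis
  have "(q^2) ^ k \<noteq> t" for k
    using t_power_eq_1[of "Suc k"] q_nonzero by (auto simp: power_inverse field_simps)
  then show ?thesis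
    using Z assms(2) by (intro weight_not_in_sum_imp_zero[of "{..<m}" t U "\<lambda>k. (q^2) ^ k" Z]) auto
qed

end

section \<open>Splitting d by the cubic q-Serre relation\<close>

text \<open>
  The map \<open>d\<close> models the action of the generator that precedes \<open>a\<close> and is opposite to \<open>b\<close>.
\<close>

locale q_serre_triple = q_weyl_pair scale Basis q a b
  for scale :: "'a::alg_closed_field \<Rightarrow> 'v::ab_group_add \<Rightarrow> 'v" and Basis and q and a b +
  fixes d :: "'v \<Rightarrow> 'v"
  assumes lin_d: "lin d"
    and weyl_d: "scale q (d (a v)) - scale (inverse q) (a (d v)) = scale (q - inverse q) v"
    and serre: "b (b (b (d v))) - scale (q_int q 3) (b (b (d (b v))))
      + scale (q_int q 3) (b (d (b (b v)))) - d (b (b (b v))) = 0"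
begin

abbreviation b_inv where "b_inv \<equiv> inv_into UNIV b"
abbreviation E_inv where "E_inv \<equiv> inv_into UNIV E"

lemma b_b_inv [simp]: "b (b_inv v) = v" and b_inv_b [simp]: "b_inv (b v) = v"
  using bij_b by (simp_all add: bij_is_surj surj_f_inv_f bij_is_inj)

lemma E_E_inv [simp]: "E (E_inv v) = v" and E_inv_E [simp]: "E_inv (E v) = v"
  using bij_E by (simp_all add: bij_is_surj surj_f_inv_f bij_is_inj)

lemma lin_b_inv: "lin b_inv"
proof (rule linI)
  show "b_inv (v + w) = b_inv v + b_inv w" for v w
    by (metis b_b_inv b_inv_b lin_abn(2) lin_b)
  show "b_inv (scale c v) = scale c (b_inv v)" for c v
    by (metis b_b_inv b_inv_b lin_abn(5) lin_b)
qed

lemmas lin_all = lin_abn lin_d lin_b_inv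

lemma q_int_3: "q_int q 3 = q^2 + 1 + inverse (q^2)"
proof -
  have "q powi 3 - q powi (- 3) = (q - inverse q) * (q^2 + 1 + inverse (q^2))"
    using q_nonzero by (simp add: power_int_minus field_simps eval_nat_numeral)
  then show ?thesis using q_minus_inverse(1) by (simp add: q_int_def)
qed

text \<open>
  Conjugation by \<open>b\<close> does not leave the span of \<open>b d b\<^sup>-\<^sup>1\<close>, \<open>d\<close> and \<open>b\<^sup>-\<^sup>1 d b\<close>: the q-Serre relation,
  conjugated once by \<open>b\<^sup>-\<^sup>1\<close>, expresses \<open>b\<^sup>2 d b\<^sup>-\<^sup>2\<close> through these three.
\<close>

lemma serre_conj:
  "b (b (d (b_inv v))) = scale (q_int q 3) (b (d v) - d (b v)) + b_inv (d (b (b v)))"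
proof -
  have "b_inv (b (b (b (d (b_inv v)))) - scale (q_int q 3) (b (b (d v)))
      + scale (q_int q 3) (b (d (b v))) - d (b (b v))) = 0"
    using serre[of "b_inv v"] by (simp add: lin_all)
  then show ?thesis
    by (simp add: lin_all scale_right_diff_distrib) (simp add: algebra_simps)
qed

definition comb :: "'a \<Rightarrow> 'a \<Rightarrow> 'a \<Rightarrow> 'v \<Rightarrow> 'v" where
  "comb x y z v = scale x (b (d (b_inv v))) + scale y (d v) + scale z (b_inv (d (b v)))"

text \<open>
  By \<open>serre_conj\<close>, conjugation by \<open>b\<close> acts on the coefficients \<open>(x, y, z)\<close> through the companion
  matrix of the cubic \<open>X\<^sup>3 - [3] X\<^sup>2 + [3] X - 1 = (X - 1) (X - q\<^sup>2) (X - t)\<close>; the assumptions are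
  the eigenvector equations of that matrix.
\<close>

lemma weight_comb:
  assumes "x * q_int q 3 + y = r * x" "z - q_int q 3 * x = r * y" "x = r * z"
  shows "weight r (comb x y z)"
  unfolding weight_def
proof
  fix v
  have "b (comb x y z v) = scale (x * q_int q 3 + y) (b (d v))
      + scale (z - q_int q 3 * x) (d (b v)) + scale x (b_inv (d (b (b v))))"
    by (simp add: comb_def lin_all serre_conj algebra_simps)
  also have "\<dots> = scale r (comb x y z (b v))"
    unfolding assms(1,2) by (simp add: comb_def lin_all scale_right_distrib assms(3))
  finally show "b (comb x y z v) = scale r (comb x y z (b v))" .
qed

lemma weight_comb_divide:
  assumes "weight r (comb x y z)"
  shows "weight r (comb (x / c) (y / c) (z / c))"
proof -
  have "comb (x / c) (y / c) (z / c) = (\<lambda>v. scale (1 / c) (comb x y z v))"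
    by (simp add: comb_def fun_eq_iff scale_right_distrib)
  then show ?thesis using weight_scale[OF assms] by simp
qed

lemma comb_add: "comb x y z v + comb x' y' z' v = comb (x + x') (y + y') (z + z') v"
  by (simp add: comb_def algebra_simps)

text \<open>
  For a root \<open>r\<close> of this cubic with the other roots \<open>r'\<close> and \<open>r''\<close>, the component of \<open>d\<close> of weight \<open>r\<close>
  is a multiple of \<open>comb 1 (- (r' + r'')) (r' * r'')\<close>. The coefficients below, for \<open>r = t\<close>, \<open>1\<close>,
  \<open>q\<^sup>2\<close> in turn, are normalised such that the three components add up to \<open>d\<close>.
\<close>

definition d_minus :: "'v \<Rightarrow> 'v" where
  "d_minus = comb (inverse q / ((q - inverse q) * (q^2 - inverse (q^2))))
    (- 1 / (q - inverse q)^2) (q / ((q - inverse q) * (q^2 - inverse (q^2))))"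

definition d_zero :: "'v \<Rightarrow> 'v" where
  "d_zero = comb (- 1 / (q - inverse q)^2) ((q^2 + inverse (q^2)) / (q - inverse q)^2)
    (- 1 / (q - inverse q)^2)"

definition d_plus :: "'v \<Rightarrow> 'v" where
  "d_plus = comb (q / ((q - inverse q) * (q^2 - inverse (q^2))))
    (- 1 / (q - inverse q)^2) (inverse q / ((q - inverse q) * (q^2 - inverse (q^2))))"

lemma q_squared_diff: "q^2 - inverse (q^2) = (q - inverse q) * (q + inverse q)"
  by (simp add: power2_eq_square algebra_simps)

lemma q_plus_inverse: "q + inverse q \<noteq> 0"
  using q_minus_inverse(3) unfolding q_squared_diff by auto

lemma inverse_square_eq:
  "1 / (q - inverse q)^2 = (q + inverse q) / ((q - inverse q) * (q^2 - inverse (q^2)))"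
proof -
  have "1 / (x * x) = y / (x * (x * y))" if "y \<noteq> 0" for x y :: 'a
    using that by simp
  then show ?thesis
    using q_plus_inverse unfolding q_squared_diff power2_eq_square[of "q - inverse q"] by blast
qed

text \<open>
  With this common denominator the weight equations reduce to identities of Laurent polynomials
  in \<open>q\<close>.
\<close>

lemma minus_inverse_square:
  "- 1 / (q - inverse q)^2 = - (q + inverse q) / ((q - inverse q) * (q^2 - inverse (q^2)))"
  using inverse_square_eq by (simp add: minus_divide_left[symmetric] del: minus_add_distrib)

lemma weight_d_minus: "weight t d_minus"
  unfolding d_minus_def minus_inverse_square using q_nonzero
  by (intro weight_comb_divide weight_comb)
    (simp_all add: q_int_3 field_simps eval_nat_numeral)

lemma weight_d_zero: "weight 1 d_zero"
  unfolding d_zero_def using q_nonzero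
  by (intro weight_comb_divide weight_comb) (simp_all add: q_int_3 algebra_simps)

lemma weight_d_plus: "weight (q^2) d_plus"
  unfolding d_plus_def minus_inverse_square using q_nonzero
  by (intro weight_comb_divide weight_comb)
    (simp_all add: q_int_3 field_simps eval_nat_numeral)

lemma d_decomposition: "d v = d_minus v + d_zero v + d_plus v"
proof -
  let ?h = "q - inverse q"
  have outer: "inverse q / (?h * (q^2 - inverse (q^2))) + q / (?h * (q^2 - inverse (q^2))) = 1 / ?h^2"
    unfolding inverse_square_eq by (simp add: add.commute flip: add_divide_distrib)
  have "q^2 + inverse (q^2) - 2 = ?h^2"
    using q_nonzero by (simp add: power2_eq_square algebra_simps)
  then have middle: "- 1 / ?h^2 + (q^2 + inverse (q^2)) / ?h^2 + - 1 / ?h^2 = 1"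
    using q_minus_inverse(1) by (simp add: field_simps)
  have "d_minus v + d_zero v + d_plus v = comb 0 1 0 v"
    unfolding d_minus_def d_zero_def d_plus_def comb_add middle
    using outer by (simp add: comb_def algebra_simps)
  then show ?thesis by (simp add: comb_def)
qed

section \<open>Conjugating d by the q-exponential\<close>

lemma lin_E_inv: "lin E_inv"
proof (rule linI)
  show "E_inv (v + w) = E_inv v + E_inv w" for v w
    by (metis E_E_inv E_inv_E lin_abn(2) lin_E)
  show "E_inv (scale c v) = scale c (E_inv v)" for c v
    by (metis E_E_inv E_inv_E lin_abn(5) lin_E)
qed

text \<open>
  Since \<open>E a E\<^sup>-\<^sup>1 = b\<^sup>-\<^sup>1\<close>, conjugating the q-Weyl relation of \<open>d\<close> and \<open>a\<close> by \<open>E\<close> gives the same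
  relation for \<open>C = E d E\<^sup>-\<^sup>1\<close> and \<open>b\<^sup>-\<^sup>1\<close>. The map \<open>b\<close> is a particular solution \<open>C\<close>, and the
  homogeneous equation \<open>q Y b\<^sup>-\<^sup>1 = q\<^sup>-\<^sup>1 b\<^sup>-\<^sup>1 Y\<close> for the difference says that \<open>Y\<close> has weight \<open>t\<close>.
\<close>

lemma weight_conj_d: "weight t (\<lambda>v. E (d (E_inv v)) - b v)"
  unfolding weight_def
proof
  fix v
  let ?C = "\<lambda>v. E (d (E_inv v))"
  have aE: "a (E_inv v) = E_inv (b_inv v)" for v
    by (metis b_E_a E_E_inv E_inv_E b_inv_b)
  have Ea: "E (a v) = b_inv (E v)" for v
    by (metis b_E_a b_inv_b)
  have "E (scale q (d (a (E_inv (b v)))) - scale (inverse q) (a (d (E_inv (b v)))))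
      = E (scale (q - inverse q) (E_inv (b v)))"
    unfolding weyl_d ..
  then have "scale q (?C v) - scale (inverse q) (b_inv (?C (b v))) = scale (q - inverse q) (b v)"
    by (simp add: lin_simps lin_E aE Ea)
  then have "b (scale q (?C v) - scale (inverse q) (b_inv (?C (b v)))) = b (scale (q - inverse q) (b v))"
    by simp
  then have "scale q (b (?C v)) - scale (inverse q) (?C (b v)) = scale (q - inverse q) (b (b v))"
    by (simp add: lin_abn)
  then have "scale q (b (?C v - b v)) = scale (inverse q) (?C (b v) - b (b v))"
    by (simp add: lin_abn algebra_simps)
  also have "\<dots> = scale q (scale t (?C (b v) - b (b v)))"
    using q_nonzero by (simp add: power2_eq_square)
  finally show "b (?C v - b v) = scale t (?C (b v) - b (b v))"
    using q_nonzero by (simp del: scale_scale)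
qed

text \<open>
  Expanding \<open>Y E = E d - b E\<close> in powers of \<open>n\<close>, with \<open>Y = E d E\<^sup>-\<^sup>1 - b\<close>, writes the map
  \<open>Y - d_minus\<close> of weight \<open>t\<close> as a sum of maps of weights \<open>q\<^sup>2\<^sup>k\<close> with \<open>k \<ge> 0\<close>, so it vanishes.
\<close>

lemma conj_d: "E (d (E_inv v)) = b v + d_minus v"
proof -
  define Y where "Y v = E (d (E_inv v)) - b v" for v
  have wY: "weight t Y" using weight_conj_d by (simp add: Y_def [abs_def])
  have linY: "lin Y"
    by (rule linI)
      (simp_all add: Y_def lin_all lin_simps lin_E lin_E_inv scale_right_diff_distrib)
  obtain m where m0: "\<And>v. (n ^^ m) v = 0" using n_nilpotent by blast
  then have m: "(n ^^ Suc m) v = 0" for v by (simp add: lin_abn)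
  have E_tail: "E v = v + (\<Sum>k<m. scale (ecoeff (Suc k)) ((n ^^ Suc k) v))" for v
    unfolding E_eq_sum[OF m]
    by (subst sum.lessThan_Suc_shift) (simp add: ecoeff_0 del: funpow.simps)
  define P where "P k v = scale (ecoeff (Suc k)) ((n ^^ Suc k) (d_minus v) - Y ((n ^^ Suc k) v))" for k v
  define Q where "Q k v = scale (ecoeff k) ((n ^^ k) (d_zero v) + (n ^^ k) (d_plus v) - b ((n ^^ k) v))" for k v
  (* In P a positive power of n accompanies the factors d_minus and Y of weight t, so its index is
     shifted by one; E_tail splits off the constant term in order to isolate Y and d_minus. *)
  have "Y v - d_minus v = (\<Sum>k<m. P k v) + (\<Sum>k<Suc m. Q k v)" for v
  proof -
    have "Y (E v) = E (d_minus v) + E (d_zero v) + E (d_plus v) - b (E v)"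
      by (simp add: Y_def lin_simps lin_E d_decomposition)
    moreover have "Y (E v) = Y v + (\<Sum>k<m. scale (ecoeff (Suc k)) (Y ((n ^^ Suc k) v)))"
      by (simp add: E_tail linY lin_simps del: funpow.simps)
    moreover have "b (E v) = (\<Sum>k<Suc m. scale (ecoeff k) (b ((n ^^ k) v)))"
      by (simp add: E_eq_sum[OF m] lin_abn del: funpow.simps sum.lessThan_Suc)
    ultimately show ?thesis
      unfolding P_def Q_def E_tail[of "d_minus v"] E_eq_sum[OF m, of "d_zero v"]
        E_eq_sum[OF m, of "d_plus v"] scale_right_diff_distrib scale_right_distrib
        sum.distrib sum_subtractf
      by (simp add: algebra_simps del: funpow.simps sum.lessThan_Suc)
  qed
  moreover have "nonneg_weights (P k)" for k
  proof (rule nonneg_weights_single[of k])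
    have "(q^2) ^ Suc k * t = (q^2) ^ k" using q_nonzero by simp
    then show "weight ((q^2) ^ k) (P k)"
      using weight_comp[OF weight_n_funpow[of "Suc k"] weight_d_minus lin_funpow[OF lin_n]]
        weight_comp[OF wY weight_n_funpow[of "Suc k"] linY]
      unfolding P_def by (intro weight_scale weight_diff) (simp_all only: mult.commute)
  qed
  moreover have "nonneg_weights (Q k)" for k
  proof -
    have "weight ((q^2) ^ k) (\<lambda>v. (n ^^ k) (d_zero v))"
      "weight ((q^2) ^ Suc k) (\<lambda>v. (n ^^ k) (d_plus v))"
      "weight ((q^2) ^ k) (\<lambda>v. b ((n ^^ k) v))"
      using weight_comp[OF weight_n_funpow[of k] weight_d_zero lin_funpow[OF lin_n]]
        weight_comp[OF weight_n_funpow[of k] weight_d_plus lin_funpow[OF lin_n]]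
        weight_comp[OF weight_b weight_n_funpow[of k] lin_b]
      by (simp_all add: mult.commute)
    then have "nonneg_weights (\<lambda>v. scale (ecoeff k) ((n ^^ k) (d_zero v) - b ((n ^^ k) v))
        + scale (ecoeff k) ((n ^^ k) (d_plus v)))"
      by (intro nonneg_weights_add nonneg_weights_single[OF weight_scale] weight_diff)
    then show ?thesis by (simp add: Q_def [abs_def] algebra_simps)
  qed
  ultimately have "nonneg_weights (\<lambda>v. Y v - d_minus v)"
    using nonneg_weights_add[OF nonneg_weights_sum[of _ P] nonneg_weights_sum[of _ Q]] by presburger
  then have "Y v - d_minus v = 0"
    using nonneg_weights_and_weight_t_imp_zero weight_diff[OF wY weight_d_minus] by blast
  then show ?thesis by (simp add: Y_def algebra_simps)
qed

lemma conj_d_formula: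
  "E (d (E_inv v)) = b v - scale (1 / (q - inverse q)^2) (d v)
    + scale (q / ((q - inverse q) * (q^2 - inverse (q^2)))) (b_inv (d (b v)))
    + scale (inverse q / ((q - inverse q) * (q^2 - inverse (q^2)))) (b (d (b_inv v)))"
proof -
  have "b v + (scale x u + scale (- 1 / c) v' + scale z w) = b v - scale (1 / c) v' + scale z w + scale x u"
    for x c z u v' w
    by (simp add: algebra_simps)
  then show ?thesis unfolding conj_d d_minus_def comb_def by blast
qed

end

section \<open>From modules over the presented algebra to linear maps\<close>

context box_module
begin

text \<open>
  The action pulled back to the free algebra, where the relations are stated.
\<close>

definition rep :: "'a free_alg \<Rightarrow> 'v \<Rightarrow> 'v" where
  "rep p = act (box_proj q p)"

lemma box_proj_closed: "box_proj q p \<in> carrier (box_alg q)"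
  using ring_hom_closed[OF box_proj_hom] by (auto simp: ring_of_type_algebra_def)

lemma lin_rep: "module_hom scale scale (rep p)"
  using act_linear[OF box_proj_closed] by (simp add: rep_def linear_iff_module_hom)

lemma rep_add: "rep (p + r) v = rep p v + rep r v"
  using ring_hom_add[OF box_proj_hom, of p r q] act_add[OF box_proj_closed box_proj_closed]
  by (simp add: rep_def ring_of_type_algebra_def)

lemma rep_mult: "rep (p * r) v = rep p (rep r v)"
  using ring_hom_mult[OF box_proj_hom, of p r q] act_mult[OF box_proj_closed box_proj_closed]
  by (simp add: rep_def ring_of_type_algebra_def)

lemma rep_1: "rep 1 v = v"
  using ring_hom_one[OF box_proj_hom, of q] act_one
  by (simp add: rep_def ring_of_type_algebra_def)

lemma rep_const: "rep (free_const c) v = scale c v"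
proof -
  have "box_proj q (free_const c * 1) = box_scale q c (box_proj q 1)"
    using ring_hom_mult[OF box_proj_hom, of "free_const c" 1 q]
    by (simp add: box_scale_def ring_of_type_algebra_def)
  then show ?thesis
    using act_scale[OF box_proj_closed, of c 1 v] rep_1[of v] by (simp add: rep_def)
qed

lemma rep_diff: "rep (p - r) v = rep p v - rep r v"
  using rep_add[of "p - r" r v] by simp

lemma rep_ideal: "p \<in> box_ideal q \<Longrightarrow> rep p v = 0"
  using box_proj_eqI[of p 0 q] rep_add[of 0 0 v] by (simp add: rep_def)

text \<open>
  The defining relations lie in the ideal, so every module satisfies them.
\<close>

lemma rep_relation:
  assumes "p \<in> range (q_weyl_rel q) \<union> range (q_serre_rel q)"
  shows "rep p v = 0"
  using assms by (intro rep_ideal) (auto simp: box_ideal_def genideal_def)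

lemmas rep_simps = rep_add rep_diff rep_mult rep_1 rep_const

lemma weyl_relation:
  assumes "q \<noteq> inverse q"
  shows "scale q (act (box_x q i) (act (box_x q (i + 1)) v))
    - scale (inverse q) (act (box_x q (i + 1)) (act (box_x q i) v)) = scale (q - inverse q) v"
proof -
  let ?w = "scale q (act (box_x q i) (act (box_x q (i + 1)) v))
    - scale (inverse q) (act (box_x q (i + 1)) (act (box_x q i) v))"
  have "scale (1 / (q - inverse q)) ?w - v = 0"
    using rep_relation[of "q_weyl_rel q i" v]
    by (simp add: q_weyl_rel_def rep_simps) (simp add: rep_def box_x_def)
  then have "scale (q - inverse q) v = scale (q - inverse q) (scale (1 / (q - inverse q)) ?w)"
    by simp
  then show ?thesis using assms by simp
qed

lemma serre_relation:
  fixes i :: 4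
  defines "x \<equiv> \<lambda>j. act (box_x q j)"
  shows "x i (x i (x i (x (i + 2) v))) - scale (q_int q 3) (x i (x i (x (i + 2) (x i v))))
      + scale (q_int q 3) (x i (x (i + 2) (x i (x i v)))) - x (i + 2) (x i (x i (x i v))) = 0"
  using rep_relation[of "q_serre_rel q i" v]
  by (simp add: q_serre_rel_def rep_simps power3_eq_cube power2_eq_square mult.assoc)
    (simp add: rep_def box_x_def x_def)

lemma lin_x: "module_hom scale scale (act (box_x q i))"
  using lin_rep by (simp add: rep_def box_x_def)

lemma act_box_n:
  "act (box_n q i) v = scale (q / (q - inverse q)) (v - act (box_x q i) (act (box_x q (i + 1)) v))"
proof -
  have "act (box_n q i) v
      = rep (free_const (q / (q - inverse q)) * (1 - free_gen i * free_gen (i + 1))) v"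
    by (simp add: rep_def box_n_def box_scale_one_minus)
  then show ?thesis by (simp add: rep_simps) (simp add: rep_def box_x_def)
qed

end

theorem theorem9p4:
  fixes q :: "'a::alg_closed_field"
    and scale :: "'a \<Rightarrow> 'v::ab_group_add \<Rightarrow> 'v"
    and Basis :: "'v set"
    and act :: "'a free_alg set \<Rightarrow> 'v \<Rightarrow> 'v"
    and i :: 4
  assumes "q \<noteq> 0"
    and "\<And>n::nat. n > 0 \<Longrightarrow> q ^ n \<noteq> 1"
    and "box_module scale q act"
    and "finite_dimensional_vector_space scale Basis"
    and "\<exists>v::'v. v \<noteq> 0"
  shows "let x = (\<lambda>j. act (box_x q j));
             x_inv = inv_into UNIV (x (i + 1));
             E = exp_q q scale (act (box_n q i))
         in E \<circ> x (i + 3) \<circ> inv_into UNIV E =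
            (\<lambda>v. x (i + 1) v
               - scale (1 / (q - inverse q)^2) (x (i + 3) v)
               + scale (q / ((q - inverse q) * (q^2 - inverse (q^2))))
                   (x_inv (x (i + 3) (x (i + 1) v)))
               + scale (inverse q / ((q - inverse q) * (q^2 - inverse (q^2))))
                   (x (i + 1) (x (i + 3) (x_inv v))))"
proof -
  interpret M: box_module scale q act by fact
  interpret endomorphism_space scale Basis
    using assms(4) by (simp add: endomorphism_space_def)
  have q: "q \<noteq> inverse q"
    using assms(1) assms(2)[of 2] by (auto simp: power2_eq_square field_simps)
  (* The numeral 4 is 0 in the index type, so the generator with index i + 3 precedes the one with
     index i and is opposite to the one with index i + 1. *)
  have four: "i + 3 + 1 = i" "i + 1 + 2 = i + 3"
    by (simp_all add: add.assoc)
  interpret q_serre_triple scale Basis q "act (box_x q i)" "act (box_x q (i + 1))"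
    "act (box_x q (i + 3))"
    using assms(1,2) M.lin_x M.weyl_relation[OF q, of i] M.weyl_relation[OF q, of "i + 3"]
      M.serre_relation[of "i + 1"]
    by (intro q_serre_triple.intro q_weyl_pair.intro q_weyl_pair_axioms.intro
        q_serre_triple_axioms.intro endomorphism_space_axioms) (simp_all only: four not_False_eq_True)
  have n_eq: "act (box_n q i) = n"
    by (simp add: fun_eq_iff n_def M.act_box_n)
  show ?thesis
    unfolding Let_def n_eq comp_def conj_d_formula ..
qed

end
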